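(* For every integer $n\geq 2$, \[ p(n\mid \text{parts}\not\equiv 12,15,27 \pmod{27}) = p(n-1\mid \text{parts}\not\equiv 6,21,27 \pmod{27}) + p(n-2\mid \text{parts}\not\equiv 3,24,27 \pmod{27}). \]
   Context: A partition of a non-negative integer $N$ is a way of writing $N$ as a sum of positive integers (parts), where order of the parts does not matter; the integer $0$ has exactly one partition (the empty one). For integers $a,b,c$ and a modulus $M\geq 1$, $p(N\mid \text{parts}\not\equiv a,b,c \pmod{M})$ denotes the number of partitions of $N$ in which no part is congruent to $a$, $b$, or $c$ modulo $M$. (Note $27\equiv 0 \pmod{27}$, so parts divisible by $27$ are excluded.) *)

theory Defs
  imports "HOL-Library.Multiset" "HOL-Number_Theory.Cong"
begin

definition partitions :: "nat \<Rightarrow> nat multiset set" where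
  "partitions N = {P. (\<forall>x \<in># P. 0 < x) \<and> sum_mset P = N}"

definition num_partitions_avoiding :: "nat \<Rightarrow> int \<Rightarrow> int \<Rightarrow> int \<Rightarrow> nat \<Rightarrow> nat" where
  "num_partitions_avoiding N a b c M =
     card {P \<in> partitions N. \<forall>x \<in># P.
       \<not> [int x = a] (mod int M) \<and> \<not> [int x = b] (mod int M) \<and> \<not> [int x = c] (mod int M)}"

text \<open>Since \<^const>\<open>card\<close> is 0 on infinite sets, finiteness of \<^const>\<open>partitions\<close>
  is needed for the definition above to be an actual count.\<close>

lemma size_le_sum_mset:
  fixes P :: "nat multiset"
  assumes "\<forall>x \<in># P. 0 < x"
  shows "size P \<le> sum_mset P"
  using assms by (induction P) (auto simp: Suc_le_eq intro: add_less_le_mono)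

lemma finite_partitions: "finite (partitions N)"
proof (rule finite_subset)
  show "partitions N \<subseteq> (\<Union>k\<le>N. multisets_of_size {..N} k)"
    using size_le_sum_mset by (auto simp: partitions_def multisets_of_size_def dest!: multi_member_split)
  show "finite (\<Union>k\<le>N. multisets_of_size {..N} k)"
    by auto
qed

lemma partitions_0: "partitions 0 = {{#}}"
  by (auto simp: partitions_def) (metis less_irrefl multiset_nonemptyE)

end

theory Submission
  imports Defs "HOL-Computational_Algebra.Formal_Power_Series"
begin

text \<open>
  Write $\theta_{M,a} = \sum_{n \in \mathbb{Z}} (-1)^n q^{M n(n-1)/2 + a n}$. By the Jacobi triple
  product, $\theta_{M,a}$ is the product of $1 - q^k$ over the $k \geq 1$ congruent to $0$ or
  $\pm a$ modulo $M$. Hence $\theta_{27,a} / \prod_k (1 - q^k)$ generates the partitions avoiding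
  $0, \pm a$ modulo $27$, and after multiplication by $\prod_k (1 - q^k)$ the claim (together with
  its initial values) becomes
  $\prod_k (1 - q^k) = \theta_{27,12} - q\,\theta_{27,21} - q^2\,\theta_{27,3}$. The left-hand side
  is $\theta_{3,1}$ (Euler's pentagonal number theorem), and the right-hand side is its dissection
  according to the residue of $n$ modulo $3$.

  Infinite products are avoided: all identities are between finite products and sums and hold for
  the coefficients below some bound. The triple product in this form follows from the $q$-binomial
  theorem.
\<close>

subsection \<open>Power series agreeing below a degree\<close>

text \<open>Congruence modulo \<open>fps_X ^ K\<close>, used in place of convergence of infinite
  products.\<close>

definition eq_upto :: "nat \<Rightarrow> 'a fps \<Rightarrow> 'a fps \<Rightarrow> bool" where
  "eq_upto K f g \<longleftrightarrow> (\<forall>n<K. fps_nth f n = fps_nth g n)"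

lemma eq_upto_refl [simp]: "eq_upto K f f"
  by (simp add: eq_upto_def)

lemma eq_upto_sym: "eq_upto K f g \<Longrightarrow> eq_upto K g f"
  by (simp add: eq_upto_def)

lemma eq_upto_trans [trans]: "eq_upto K f g \<Longrightarrow> eq_upto K g h \<Longrightarrow> eq_upto K f h"
  by (simp add: eq_upto_def)

lemma eq_upto_mono: "eq_upto K f g \<Longrightarrow> L \<le> K \<Longrightarrow> eq_upto L f g"
  by (simp add: eq_upto_def)

lemma eq_upto_diff:
  "eq_upto K f g \<Longrightarrow> eq_upto K f' g' \<Longrightarrow> eq_upto K (f - f') (g - g' :: 'a::ab_group_add fps)"
  by (simp add: eq_upto_def)

lemma eq_upto_sum:
  "(\<And>i. i \<in> A \<Longrightarrow> eq_upto K (f i) (g i)) \<Longrightarrow>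
    eq_upto K (\<Sum>i\<in>A. f i) (\<Sum>i\<in>A. g i :: 'a::comm_monoid_add fps)"
  by (simp add: eq_upto_def fps_sum_nth)

lemma eq_upto_mult:
  fixes f g f' g' :: "'a::semiring_1 fps"
  assumes "eq_upto K f g" "eq_upto K f' g'"
  shows "eq_upto K (f * f') (g * g')"
  using assms by (auto simp: eq_upto_def fps_mult_nth intro!: sum.cong)

text \<open>A factor \<open>fps_X ^ k\<close> gains \<open>k\<close> coefficients of precision. This
  rescues the coarsely approximated terms near the ends of the theta sum.\<close>

lemma eq_upto_X_power_mult:
  fixes f g :: "'a::semiring_1 fps"
  assumes "eq_upto K f g" "L \<le> K + k"
  shows "eq_upto L (fps_X ^ k * f) (fps_X ^ k * g)"
  using assms by (auto simp: eq_upto_def fps_X_power_mult_nth)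

lemma eq_upto_mult_cancel:
  fixes f g u :: "'a::field fps"
  assumes "eq_upto K (f * u) (g * u)" "fps_nth u 0 \<noteq> 0"
  shows "eq_upto K f g"
proof -
  have "eq_upto K (f * u * inverse u) (g * u * inverse u)"
    by (intro eq_upto_mult assms eq_upto_refl)
  thus ?thesis
    using assms(2) by (simp add: mult.assoc inverse_mult_eq_1')
qed

subsection \<open>The \<open>q\<close>-binomial theorem\<close>

definition qpoch :: "'a::comm_ring_1 \<Rightarrow> nat \<Rightarrow> 'a" where
  "qpoch q m = (\<Prod>k<m. 1 - q ^ Suc k)"

lemma qpoch_0 [simp]: "qpoch q 0 = 1"
  by (simp add: qpoch_def)

lemma qpoch_Suc [simp]: "qpoch q (Suc m) = qpoch q m * (1 - q ^ Suc m)"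
  by (simp add: qpoch_def)

text \<open>Gaussian binomial coefficients via a Pascal recurrence, which needs no division in the
  ring.\<close>

fun qbinomial :: "'a::comm_ring_1 \<Rightarrow> nat \<Rightarrow> nat \<Rightarrow> 'a" where
  "qbinomial q m 0 = 1"
| "qbinomial q 0 (Suc j) = 0"
| "qbinomial q (Suc m) (Suc j) = qbinomial q m (Suc j) + q ^ (m - j) * qbinomial q m j"

lemma qbinomial_eq_0: "m < j \<Longrightarrow> qbinomial q m j = 0"
  by (induction q m j rule: qbinomial.induct) auto

text \<open>The quotient formula with denominators cleared. For \<open>m = Suc (j + d)\<close> the
  Pascal step amounts to \<open>(1 - q ^ Suc d) + q ^ Suc d * (1 - q ^ Suc j) = 1 - q ^ Suc
  m\<close>.\<close>

lemma qbinomial_mult_qpoch: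
  "j \<le> m \<Longrightarrow> qbinomial q m j * (qpoch q j * qpoch q (m - j)) = qpoch q m"
proof (induction q m j rule: qbinomial.induct)
  case (3 q m j)
  show ?case
  proof (cases "j = m")
    case True
    thus ?thesis using 3 by (simp add: qbinomial_eq_0 mult.assoc[symmetric])
  next
    case False
    with 3 obtain d where d: "m = Suc (j + d)"
      by (metis le_neq_implies_less less_iff_Suc_add Suc_le_mono)
    from 3 d have IH1: "qbinomial q m (Suc j) * (qpoch q (Suc j) * qpoch q d) = qpoch q m"
      and IH2: "qbinomial q m j * (qpoch q j * qpoch q (Suc d)) = qpoch q m" by auto
    have "qbinomial q (Suc m) (Suc j) * (qpoch q (Suc j) * qpoch q (Suc d))
        = (qbinomial q m (Suc j) * (qpoch q (Suc j) * qpoch q d)) * (1 - q ^ Suc d)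
        + q ^ Suc d * (1 - q ^ Suc j) * (qbinomial q m j * (qpoch q j * qpoch q (Suc d)))"
      using d by (simp add: algebra_simps)
    also have "\<dots> = qpoch q m * (1 - q ^ Suc m)"
      unfolding IH1 IH2 using d by (simp add: algebra_simps power_add)
    finally show ?thesis using d by simp
  qed
qed auto

lemma triangle_Suc: "Suc j * (Suc j - 1) div 2 = j * (j - 1) div 2 + (j::nat)"
  by (cases j) (simp_all add: algebra_simps)

text \<open>Induction on \<open>m\<close>, multiplying by the last factor
  \<open>x + y * q ^ m\<close>. The Pascal weight \<open>q ^ (m - j)\<close> and the increment
  \<open>j\<close> of the triangular exponent combine to \<open>q ^ m\<close>.\<close>

lemma q_binomial_theorem:
  fixes x y q :: "'a::comm_ring_1"
  shows "(\<Prod>k<m. x + y * q ^ k)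
    = (\<Sum>j\<le>m. q ^ (j * (j - 1) div 2) * qbinomial q m j * y ^ j * x ^ (m - j))"
proof (induction m)
  case (Suc m)
  define t where "t m j = q ^ (j * (j - 1) div 2) * qbinomial q m j * y ^ j * x ^ (m - j)" for m j
  have step: "t (Suc m) (Suc j) = t m (Suc j) * x + t m j * (y * q ^ m)" if "j \<le> m" for j
  proof (cases "j = m")
    case True
    thus ?thesis
      unfolding t_def triangle_Suc by (simp add: qbinomial_eq_0 power_add algebra_simps)
  next
    case False
    with that obtain d where d: "m = Suc (j + d)"
      by (metis le_neq_implies_less less_iff_Suc_add)
    show ?thesis
      unfolding t_def triangle_Suc d by (simp add: power_add algebra_simps)
  qed
  have "(\<Prod>k<Suc m. x + y * q ^ k) = (\<Sum>j\<le>m. t m j) * (x + y * q ^ m)"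
    using Suc by (simp add: t_def)
  also have "\<dots> = (\<Sum>j\<le>m. t m j) * x + (\<Sum>j\<le>m. t m j * (y * q ^ m))"
    by (simp only: sum_distrib_right distrib_left)
  \<comment> \<open>The added term vanishes because \<open>qbinomial q m (Suc m) = 0\<close>; it
    lets the shifted sum run over the same range as the other one.\<close>
  also have "(\<Sum>j\<le>m. t m j) = (\<Sum>j\<le>Suc m. t m j)"
    by (simp add: t_def qbinomial_eq_0)
  also have "\<dots> = t m 0 + (\<Sum>j\<le>m. t m (Suc j))"
    by (rule sum.atMost_Suc_shift)
  also have "(t m 0 + (\<Sum>j\<le>m. t m (Suc j))) * x + (\<Sum>j\<le>m. t m j * (y * q ^ m))
      = t m 0 * x + (\<Sum>j\<le>m. t m (Suc j) * x + t m j * (y * q ^ m))"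
    by (simp only: sum_distrib_right distrib_right sum.distrib add.assoc)
  also have "\<dots> = t (Suc m) 0 + (\<Sum>j\<le>m. t (Suc m) (Suc j))"
    using step by (simp add: t_def)
  also have "\<dots> = (\<Sum>j\<le>Suc m. t (Suc m) j)"
    by (rule sum.atMost_Suc_shift[symmetric])
  finally show ?case by (simp only: t_def)
qed simp

subsection \<open>The Jacobi triple product\<close>

text \<open>Each factor after the first \<open>c\<close> is 1 minus a power of \<open>fps_X\<close>
  of exponent at least \<open>M * Suc c\<close>, hence invisible at this precision.\<close>

lemma eq_upto_qpoch:
  assumes "c \<le> m"
  shows "eq_upto (M * Suc c) (qpoch (fps_X ^ M) m) (qpoch (fps_X ^ M) c :: 'a::comm_ring_1 fps)"
  using assms
proof (induction m rule: dec_induct)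
  case (step m)
  let ?q = "fps_X ^ M :: 'a fps"
  have "eq_upto (M * Suc c) (fps_X ^ (M * Suc m) * qpoch ?q m) 0"
    using step by (simp add: eq_upto_def fps_X_power_mult_nth)
      (metis Suc_le_mono add_le_mono le_refl le_trans mult_le_mono2 mult_Suc_right not_less)
  hence "eq_upto (M * Suc c) (qpoch ?q m - fps_X ^ (M * Suc m) * qpoch ?q m) (qpoch ?q c - 0)"
    by (intro eq_upto_diff step.IH)
  also have "qpoch ?q m - fps_X ^ (M * Suc m) * qpoch ?q m = qpoch ?q (Suc m)"
    by (simp only: qpoch_Suc power_mult) (simp add: algebra_simps)
  finally show ?case by simp
qed simp

lemma qpoch_X_power_nth_0: "0 < M \<Longrightarrow> fps_nth (qpoch (fps_X ^ M) m :: 'a::comm_ring_1 fps) 0 = 1"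
  by (induction m) (auto simp flip: power_Suc power_mult)

text \<open>The indices \<open>m\<close>, \<open>j\<close>, \<open>m - j\<close> and
  \<open>N\<close> are all at least \<open>c\<close>, so their \<open>qpoch\<close> values agree at
  this precision and cancel in the quotient formula.\<close>

lemma eq_upto_qbinomial:
  fixes M :: nat
  assumes "0 < M" "c \<le> j" "j + c \<le> m" "c \<le> N"
  shows "eq_upto (M * Suc c) (qbinomial (fps_X ^ M) m j * qpoch (fps_X ^ M) N) (1 :: 'a::field fps)"
proof -
  let ?q = "fps_X ^ M :: 'a fps"
  let ?K = "M * Suc c"
  have eq: "eq_upto ?K (qpoch ?q d) (qpoch ?q N)" if "c \<le> d" for d
    using eq_upto_trans[OF eq_upto_qpoch[OF that] eq_upto_sym[OF eq_upto_qpoch[OF assms(4)]]] .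
  have "eq_upto ?K (qbinomial ?q m j * (qpoch ?q N * qpoch ?q N))
      (qbinomial ?q m j * (qpoch ?q j * qpoch ?q (m - j)))"
    using assms by (intro eq_upto_mult eq_upto_refl eq_upto_sym[OF eq]) auto
  also have "qbinomial ?q m j * (qpoch ?q j * qpoch ?q (m - j)) = qpoch ?q m"
    using assms by (intro qbinomial_mult_qpoch) auto
  also have "eq_upto ?K \<dots> (qpoch ?q N)"
    using assms by (intro eq) auto
  finally have "eq_upto ?K ((qbinomial ?q m j * qpoch ?q N) * qpoch ?q N) (1 * qpoch ?q N)"
    by (simp add: mult.assoc)
  thus ?thesis
    by (rule eq_upto_mult_cancel) (simp add: qpoch_X_power_nth_0 assms)
qed

text \<open>For \<open>a \<le> M\<close> the integer exponent is nonnegative, so \<open>nat\<close>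
  truncates nothing.\<close>

definition theta_exp :: "nat \<Rightarrow> nat \<Rightarrow> int \<Rightarrow> nat" where
  "theta_exp M a n = nat (int M * (n * (n - 1) div 2) + int a * n)"

definition theta_term :: "nat \<Rightarrow> nat \<Rightarrow> int \<Rightarrow> 'a::comm_ring_1 fps" where
  "theta_term M a n = (if even n then 1 else -1) * fps_X ^ theta_exp M a n"

lemma int_triangle: "2 * (n * (n - 1) div 2) = n * (n - 1 :: int)"
  by simp

lemma of_nat_theta_exp:
  assumes "a \<le> M"
  shows "2 * int (theta_exp M a n) = int M * (n * (n - 1)) + 2 * int a * n"
proof -
  have "0 \<le> int M * (n * (n - 1)) + 2 * int a * n"
  proof (cases "n \<ge> 0")
    case True
    hence "0 \<le> n * (n - 1)" by (cases "n = 0") auto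
    with True show ?thesis by simp
  next
    case False
    have "int M * (n * (n - 1)) + 2 * int a * n = int M * (n * (n + 1)) + 2 * (int M - int a) * (- n)"
      by (simp add: algebra_simps)
    moreover have "0 \<le> int M * (n * (n + 1))"
      using False by (intro mult_nonneg_nonneg mult_nonpos_nonpos) auto
    moreover have "0 \<le> (int M - int a) * (- n)" using False assms by (intro mult_nonneg_nonneg) auto
    ultimately show ?thesis by (simp only: mult.assoc)
  qed
  moreover have "2 * (int M * (n * (n - 1) div 2) + int a * n) = int M * (n * (n - 1)) + 2 * int a * n"
    using int_triangle[of n] by (simp add: algebra_simps)
  moreover have "2 * int (nat z) = w" if "0 \<le> w" "2 * z = w" for z w :: int
    using that by simp
  ultimately show ?thesis
    unfolding theta_exp_def by blast
qed

text \<open>The left side is the exponent of \<open>fps_X\<close> in the \<open>j\<close>-th term of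
  the expansion below. Apart from the theta exponent at \<open>j - N\<close>, it is independent of
  \<open>j\<close> and can be factored out.\<close>

lemma theta_exp_shift:
  assumes "a \<le> M" "j \<le> 2 * N"
  shows "M * (j * (j - 1) div 2) + a * j + M * N * (2 * N - j)
       = a * N + M * (N * (N - 1) div 2) + M * N * N + theta_exp M a (int j - int N)"
proof -
  have tri: "2 * int (i * (i - 1) div 2) = int i * (int i - 1)" for i :: nat
    by (cases i) (simp_all add: zdiv_int algebra_simps)
  have "2 * int (M * (j * (j - 1) div 2) + a * j + M * N * (2 * N - j))
    = int M * (2 * int (j * (j - 1) div 2)) + 2 * int a * int j + 2 * int M * int N * (2 * int N - int j)"
    using assms(2) by (simp only: of_nat_add of_nat_mult of_nat_diff) (simp add: distrib_left)
  also have "\<dots> = 2 * int a * int N + int M * (2 * int (N * (N - 1) div 2)) + 2 * int M * int N * int N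
     + 2 * int (theta_exp M a (int j - int N))"
    unfolding tri of_nat_theta_exp[OF assms(1)] by (simp add: algebra_simps)
  also have "\<dots> = 2 * int (a * N + M * (N * (N - 1) div 2) + M * N * N + theta_exp M a (int j - int N))"
    by (simp add: algebra_simps)
  finally show ?thesis by (simp only: mult_cancel_left of_nat_eq_iff) simp
qed

lemma prod_lessThan_add:
  fixes f :: "nat \<Rightarrow> 'a::comm_monoid_mult"
  shows "(\<Prod>k<m + n. f k) = (\<Prod>k<m. f k) * (\<Prod>k<n. f (m + k))"
  by (induction n) (simp_all add: mult.assoc)

lemma bij_betw_shift: "bij_betw (\<lambda>j. int j - int N) {..2 * N} {- int N..int N}"
  by (rule bij_betwI[where g = "\<lambda>n. nat (n + int N)"]) auto

text \<open>
  In the homogeneous $q$-binomial theorem take $x = q^N$ and $y = -z$ with $z$ the $a$-th power of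
  the variable: this is the classical substitution $t = -z q^{-N}$ without negative exponents.
\<close>

lemma finite_triple_product:
  fixes M a N :: nat
  assumes "a \<le> M"
  defines "q \<equiv> fps_X ^ M :: 'a::idom fps"
  shows "(\<Prod>i<N. (1 - fps_X ^ (M * i + a)) * (1 - fps_X ^ (M * Suc i - a)))
     = (\<Sum>n = - int N..int N. theta_term M a n * qbinomial q (2 * N) (nat (n + int N)))"
proof -
  define x y :: "'a fps" where "x = q ^ N" and "y = - (fps_X ^ a)"
  define C where "C = a * N + M * (N * (N - 1) div 2) + M * N * N"
  \<comment> \<open>The monomials that will be pulled out of the lower \<open>N\<close>
    factors.\<close>
  have low: "(\<Prod>k<n. - (fps_X ^ a) * q ^ k) = (- 1) ^ n * fps_X ^ (a * n + M * (n * (n - 1) div 2))" for n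
  proof (induction n)
    case (Suc n)
    have "(\<Prod>k<Suc n. - (fps_X ^ a) * q ^ k) = (- 1) ^ Suc n * fps_X ^ (a * n + M * (n * (n - 1) div 2) + (a + M * n))"
      using Suc by (simp only: prod.lessThan_Suc q_def power_add power_mult power_Suc) (simp add: algebra_simps)
    also have "a * n + M * (n * (n - 1) div 2) + (a + M * n) = a * Suc n + M * (Suc n * (Suc n - 1) div 2)"
      unfolding triangle_Suc by (simp add: algebra_simps)
    finally show ?case .
  qed simp
  have "(\<Prod>k<2 * N. x + y * q ^ k) = (\<Prod>k<N. x + y * q ^ k) * (\<Prod>k<N. x + y * q ^ (N + k))"
    unfolding mult_2 by (rule prod_lessThan_add)
  \<comment> \<open>For \<open>k < N\<close> the term \<open>y * q ^ k\<close> divides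
    \<open>x = q ^ N\<close> because \<open>a \<le> M\<close>, so it is pulled out here; in the
    upper half \<open>x\<close> is pulled out instead.\<close>
  also have "(\<Prod>k<N. x + y * q ^ k) = (\<Prod>k<N. (- (fps_X ^ a) * q ^ k) * (1 - fps_X ^ (M * Suc (N - Suc k) - a)))"
  proof (rule prod.cong)
    fix k assume "k \<in> {..<N}"
    then obtain d where d: "N = k + Suc d" by (auto simp: less_iff_Suc_add)
    have "x = fps_X ^ (M * k + (a + (M * Suc d - a)))"
      using assms by (simp add: x_def q_def d power_mult[symmetric] power_add[symmetric] algebra_simps)
    also have "\<dots> = q ^ k * (fps_X ^ a * fps_X ^ (M * Suc d - a))"
      unfolding q_def by (simp only: power_add power_mult)
    finally show "x + y * q ^ k = (- (fps_X ^ a) * q ^ k) * (1 - fps_X ^ (M * Suc (N - Suc k) - a))"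
      using d by (simp add: y_def algebra_simps)
  qed simp
  also have "\<dots> = (\<Prod>k<N. - (fps_X ^ a) * q ^ k) * (\<Prod>i<N. 1 - fps_X ^ (M * Suc i - a))"
    by (simp only: prod.distrib prod.nat_diff_reindex[of "\<lambda>i. 1 - fps_X ^ (M * Suc i - a)"])
  also have "(\<Prod>k<N. x + y * q ^ (N + k)) = (\<Prod>i<N. x * (1 - fps_X ^ (M * i + a)))"
    by (intro prod.cong) (simp_all add: x_def y_def q_def power_mult[symmetric] power_add[symmetric] algebra_simps)
  also have "\<dots> = fps_X ^ (M * N * N) * (\<Prod>i<N. 1 - fps_X ^ (M * i + a))"
    by (simp add: prod.distrib x_def q_def power_mult)
  finally have lhs: "(\<Prod>k<2 * N. x + y * q ^ k) = (- 1) ^ N * fps_X ^ C *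
      (\<Prod>i<N. (1 - fps_X ^ (M * i + a)) * (1 - fps_X ^ (M * Suc i - a)))"
    unfolding low C_def by (simp only: prod.distrib power_add mult_ac)
  have "(\<Prod>k<2 * N. x + y * q ^ k)
      = (\<Sum>j\<le>2 * N. q ^ (j * (j - 1) div 2) * qbinomial q (2 * N) j * y ^ j * x ^ (2 * N - j))"
    by (rule q_binomial_theorem)
  also have "\<dots> = (\<Sum>j\<le>2 * N. (- 1) ^ N * fps_X ^ C *
      (theta_term M a (int j - int N) * qbinomial q (2 * N) (nat (int j - int N + int N))))"
  proof (rule sum.cong)
    fix j assume "j \<in> {..2 * N}"
    hence j: "j \<le> 2 * N" by simp
    have "q ^ (j * (j - 1) div 2) * qbinomial q (2 * N) j * y ^ j * x ^ (2 * N - j)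
       = (- 1) ^ j * fps_X ^ (M * (j * (j - 1) div 2) + a * j + M * N * (2 * N - j)) * qbinomial q (2 * N) j"
      unfolding q_def x_def y_def power_minus[of "fps_X ^ a"]
      by (simp only: power_add power_mult) (simp add: algebra_simps)
    also have "M * (j * (j - 1) div 2) + a * j + M * N * (2 * N - j) = C + theta_exp M a (int j - int N)"
      unfolding C_def by (rule theta_exp_shift[OF assms(1) j])
    also have "(- 1) ^ j = (- 1) ^ N * (if even (int j - int N) then 1 else - 1 :: 'a fps)"
      by (auto simp: minus_one_power_iff)
    finally show "q ^ (j * (j - 1) div 2) * qbinomial q (2 * N) j * y ^ j * x ^ (2 * N - j)
      = (- 1) ^ N * fps_X ^ C *
        (theta_term M a (int j - int N) * qbinomial q (2 * N) (nat (int j - int N + int N)))"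
      by (simp only: theta_term_def power_add diff_add_cancel nat_int mult_ac)
  qed simp
  also have "\<dots> = (\<Sum>n = - int N..int N. (- 1) ^ N * fps_X ^ C *
      (theta_term M a n * qbinomial q (2 * N) (nat (n + int N))))"
    by (rule sum.reindex_bij_betw[OF bij_betw_shift])
  \<comment> \<open>Both expansions carry the nonzero factor \<open>(- 1) ^ N * fps_X ^ C\<close>,
    which cancels in an integral domain.\<close>
  finally show ?thesis
    unfolding lhs sum_distrib_left[symmetric] by simp
qed

text \<open>Precision of the \<open>n\<close>-th binomial plus the order of the \<open>n\<close>-th
  theta term reaches \<open>M * N\<close>. With \<open>m = \<bar>n\<bar>\<close> this rests on
  \<open>(m - 1) * (m - 2) \<ge> 0\<close>, which holds for integers.\<close>

lemma theta_exp_order: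
  assumes "a \<le> M" "\<bar>n\<bar> \<le> int N"
  shows "M * N \<le> M * Suc (nat (int N - \<bar>n\<bar>)) + theta_exp M a n"
proof -
  have quad: "0 \<le> (m - 1) * (m - 2)" if "0 \<le> m" for m :: int
    using that by (cases "m = 0 \<or> m = 1") auto
  have "0 \<le> int M * (2 - 2 * \<bar>n\<bar>) + (int M * (n * (n - 1)) + 2 * int a * n)"
  proof (cases "0 \<le> n")
    case True
    hence "int M * (2 - 2 * \<bar>n\<bar>) + (int M * (n * (n - 1)) + 2 * int a * n)
        = int M * ((n - 1) * (n - 2)) + 2 * int a * n"
      by (simp add: algebra_simps)
    moreover have "0 \<le> int M * ((n - 1) * (n - 2))"
      using quad[OF True] by simp
    ultimately show ?thesis using True by (metis add_nonneg_nonneg mult_nonneg_nonneg of_nat_0_le_iff zero_le_numeral)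
  next
    case False
    hence "int M * (2 - 2 * \<bar>n\<bar>) + (int M * (n * (n - 1)) + 2 * int a * n)
        = int M * ((- n - 1) * (- n - 2)) + 2 * ((int M - int a) * (- n))"
      by (simp add: algebra_simps)
    moreover have "0 \<le> (int M - int a) * (- n)"
      using False assms by (intro mult_nonneg_nonneg) auto
    moreover have "0 \<le> int M * ((- n - 1) * (- n - 2))"
      using quad[of "- n"] False by simp
    ultimately show ?thesis by linarith
  qed
  hence "2 * int (M * N) \<le> 2 * (int M * (1 + (int N - \<bar>n\<bar>))) + 2 * int (theta_exp M a n)"
    unfolding of_nat_theta_exp[OF assms(1)] by (simp add: algebra_simps)
  also have "\<dots> = 2 * int (M * Suc (nat (int N - \<bar>n\<bar>)) + theta_exp M a n)"
    using assms(2) by (simp add: distrib_left)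
  finally show ?thesis
    by (simp only: mult_le_cancel_left_pos zero_less_numeral of_nat_le_iff)
qed

lemma triple_product_eq_upto:
  fixes M a N :: nat
  assumes "0 < M" "a \<le> M"
  shows "eq_upto (M * N)
     (\<Prod>i<N. (1 - fps_X ^ (M * i + a)) * (1 - fps_X ^ (M * Suc i - a)) * (1 - fps_X ^ (M * Suc i)))
     (\<Sum>n = - int N..int N. theta_term M a n :: 'a::field fps)"
proof -
  let ?q = "fps_X ^ M :: 'a fps"
  have "(\<Prod>i<N. (1 - fps_X ^ (M * i + a)) * (1 - fps_X ^ (M * Suc i - a)) * (1 - fps_X ^ (M * Suc i)))
    = (\<Prod>i<N. (1 - fps_X ^ (M * i + a)) * (1 - fps_X ^ (M * Suc i - a))) * qpoch ?q N"
    unfolding qpoch_def by (simp only: prod.distrib power_mult)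
  also have "\<dots> = (\<Sum>n = - int N..int N.
      theta_term M a n * (qbinomial ?q (2 * N) (nat (n + int N)) * qpoch ?q N))"
    unfolding finite_triple_product[OF assms(2)] by (simp add: sum_distrib_right mult.assoc)
  also have "eq_upto (M * N) \<dots> (\<Sum>n = - int N..int N. theta_term M a n)"
  proof (rule eq_upto_sum)
    fix n assume n: "n \<in> {- int N..int N}"
    \<comment> \<open>Both lower indices \<open>N + n\<close> and \<open>N - n\<close> of the
      central binomial are at least this \<open>c\<close>.\<close>
    define c where "c = nat (int N - \<bar>n\<bar>)"
    have "eq_upto (M * Suc c) (qbinomial ?q (2 * N) (nat (n + int N)) * qpoch ?q N) 1"
      using n assms by (intro eq_upto_qbinomial) (auto simp: c_def)
    hence "eq_upto (M * N)
        (fps_X ^ theta_exp M a n * (qbinomial ?q (2 * N) (nat (n + int N)) * qpoch ?q N))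
        (fps_X ^ theta_exp M a n * 1)"
      unfolding c_def using n assms(2) by (intro eq_upto_X_power_mult[OF _ theta_exp_order]) auto
    from eq_upto_mult[OF eq_upto_refl this]
    show "eq_upto (M * N)
        (theta_term M a n * (qbinomial ?q (2 * N) (nat (n + int N)) * qpoch ?q N)) (theta_term M a n)"
      by (simp only: theta_term_def mult.assoc mult_1_right)
  qed
  finally show ?thesis .
qed

text \<open>Each block of \<open>M\<close> consecutive integers meets each of the three classes
  once; \<open>2 * a \<noteq> M\<close> keeps the classes of \<open>a\<close> and
  \<open>M - a\<close> apart.\<close>

lemma prod_residues_eq_triple_product:
  fixes M a N :: nat and f :: "nat \<Rightarrow> 'a::comm_monoid_mult"
  assumes "0 < a" "a < M" "2 * a \<noteq> M"
  shows "(\<Prod>k | k \<in> {1..M * N} \<and> k mod M \<in> {0, a, M - a}. f k)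
      = (\<Prod>i<N. f (M * i + a) * f (M * Suc i - a) * f (M * Suc i))"
proof (induction N)
  case (Suc N)
  define S where "S N = {k. k \<in> {1..M * N} \<and> k mod M \<in> {0, a, M - a}}" for N
  have "S (Suc N) = S N \<union> {M * N + a, M * Suc N - a, M * Suc N}"
  proof (intro equalityI subsetI)
    fix k assume k: "k \<in> S (Suc N)"
    show "k \<in> S N \<union> {M * N + a, M * Suc N - a, M * Suc N}"
    proof (cases "k \<le> M * N")
      case True
      thus ?thesis using k by (auto simp: S_def)
    next
      case False
      then obtain r where r: "k = M * N + r" "0 < r"
        by (metis add_diff_inverse_nat less_imp_le not_less zero_less_diff le_add_diff_inverse)
      with k have "r \<le> M" "r mod M \<in> {0, a, M - a}" by (auto simp: S_def)
      \<comment> \<open>Offsets run over \<open>1..M\<close>, so residue 0 appears as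
        \<open>r = M\<close>.\<close>
      hence "r = a \<or> r = M - a \<or> r = M"
        using r(2) by (cases "r = M") auto
      thus ?thesis using assms r by auto
    qed
  next
    fix k assume "k \<in> S N \<union> {M * N + a, M * Suc N - a, M * Suc N}"
    moreover have "(M * Suc N - a) mod M = M - a"
    proof -
      have "M * Suc N - a = M * N + (M - a)" using assms by simp
      moreover have "(M * N + (M - a)) mod M = M - a" using assms by (simp only: mod_mult_self4) simp
      ultimately show ?thesis by simp
    qed
    ultimately show "k \<in> S (Suc N)"
      using assms by (auto simp: S_def)
  qed
  moreover have "finite (S N)" by (simp add: S_def)
  moreover have "S N \<inter> {M * N + a, M * Suc N - a, M * Suc N} = {}"
    using assms by (auto simp: S_def)
  ultimately have "prod f (S (Suc N)) = prod f (S N) * prod f {M * N + a, M * Suc N - a, M * Suc N}"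
    by (simp only: prod.union_disjoint finite.intros)
  also have "prod f {M * N + a, M * Suc N - a, M * Suc N}
      = f (M * N + a) * f (M * Suc N - a) * f (M * Suc N)"
  proof -
    have "M * N + a \<noteq> M * Suc N - a" "M * N + a \<noteq> M * Suc N" "M * Suc N - a \<noteq> M * Suc N"
      using assms by auto
    thus ?thesis by (simp add: mult.assoc del: mult_Suc_right)
  qed
  finally show ?case using Suc by (simp add: S_def del: mult_Suc_right)
qed auto

corollary prod_residues_eq_upto:
  assumes "0 < a" "a < M" "2 * a \<noteq> M"
  shows "eq_upto (M * N) (\<Prod>k | k \<in> {1..M * N} \<and> k mod M \<in> {0, a, M - a}. 1 - fps_X ^ k)
     (\<Sum>n = - int N..int N. theta_term M a n :: 'a::field fps)"
  using triple_product_eq_upto[of M a N] assms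
  by (simp only: prod_residues_eq_triple_product[OF assms]) simp

subsection \<open>Generating functions of partitions\<close>

text \<open>Coefficients are real, although they are counts, to allow subtraction and cancellation
  over a field.\<close>

definition partition_gf :: "nat set \<Rightarrow> real fps" where
  "partition_gf T = Abs_fps (\<lambda>n. real (card {P \<in> partitions n. set_mset P \<subseteq> T}))"

lemma partition_gf_nth: "fps_nth (partition_gf T) n = real (card {P \<in> partitions n. set_mset P \<subseteq> T})"
  by (simp add: partition_gf_def)

lemma partition_gf_empty: "partition_gf {} = 1"
proof (rule fps_ext)
  fix n
  have "{P \<in> partitions n. set_mset P \<subseteq> {}} = (if n = 0 then {{#}} else {})"
    by (auto simp: partitions_def)
  thus "fps_nth (partition_gf {}) n = fps_nth 1 n"
    by (simp add: partition_gf_nth)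
qed

text \<open>A partition either omits \<open>k\<close> or arises by adding one copy of
  \<open>k\<close> to a partition that may itself contain \<open>k\<close>.\<close>

lemma partition_gf_insert:
  assumes "k \<notin> T" "0 < k"
  shows "partition_gf (insert k T) * (1 - fps_X ^ k) = partition_gf T"
proof -
  have "fps_nth (partition_gf (insert k T)) n
      = fps_nth (partition_gf T) n + fps_nth (fps_X ^ k * partition_gf (insert k T)) n" for n
  proof -
    let ?A = "\<lambda>T n. {P \<in> partitions n. set_mset P \<subseteq> T}"
    let ?B = "{P \<in> ?A (insert k T) n. k \<in># P}"
    have "?A (insert k T) n = ?A T n \<union> ?B" "?A T n \<inter> ?B = {}"
      using assms by auto
    hence "card (?A (insert k T) n) = card (?A T n) + card ?B"
      by (metis (no_types, lifting) card_Un_disjoint finite_Un finite_partitions finite_subset mem_Collect_eq subsetI)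
    moreover have "card ?B = (if n < k then 0 else card (?A (insert k T) (n - k)))"
    proof (cases "n < k")
      case True
      hence "?B = {}"
        by (auto simp: partitions_def dest!: multi_member_split)
      with True show ?thesis by (simp only: card.empty if_True)
    next
      case False
      have "?B = add_mset k ` ?A (insert k T) (n - k)"
      proof (intro equalityI subsetI)
        fix P assume "P \<in> ?B"
        moreover from this obtain Q where "P = add_mset k Q"
          by (auto dest!: multi_member_split)
        ultimately show "P \<in> add_mset k ` ?A (insert k T) (n - k)"
          by (auto simp: partitions_def)
      next
        fix P assume "P \<in> add_mset k ` ?A (insert k T) (n - k)"
        thus "P \<in> ?B" using False assms by (auto simp: partitions_def)
      qed
      hence "card ?B = card (?A (insert k T) (n - k))"
        using card_image[of "add_mset k" "?A (insert k T) (n - k)"] by (simp add: inj_on_def)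
      with False show ?thesis by simp
    qed
    ultimately show ?thesis
      by (simp add: partition_gf_nth fps_X_power_mult_nth)
  qed
  hence "partition_gf (insert k T) = partition_gf T + fps_X ^ k * partition_gf (insert k T)"
    by (intro fps_ext) (simp only: fps_add_nth)
  thus ?thesis by (simp add: algebra_simps)
qed

lemma partition_gf_finite:
  assumes "finite T" "0 \<notin> T"
  shows "partition_gf T * (\<Prod>k\<in>T. 1 - fps_X ^ k) = 1"
  using assms
proof (induction T rule: finite_induct)
  case (insert k T)
  have "partition_gf (insert k T) * (\<Prod>k\<in>insert k T. 1 - fps_X ^ k)
      = (partition_gf (insert k T) * (1 - fps_X ^ k)) * (\<Prod>k\<in>T. 1 - fps_X ^ k)"
    using insert by (simp add: mult.assoc)
  also have "\<dots> = 1"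
    using insert by (simp add: partition_gf_insert)
  finally show ?case .
qed (simp add: partition_gf_empty)

lemma partition_gf_eq_upto: "eq_upto (Suc K) (partition_gf T) (partition_gf (T \<inter> {1..K}))"
proof -
  have "{P \<in> partitions n. set_mset P \<subseteq> T} = {P \<in> partitions n. set_mset P \<subseteq> T \<inter> {1..K}}" if "n \<le> K" for n
    using that by (force simp: partitions_def dest: multi_member_split)
  thus ?thesis by (simp add: eq_upto_def partition_gf_nth)
qed

text \<open>Partitions of numbers up to \<open>K\<close> use only parts up to \<open>K\<close>, so
  the finite product formula applies: the factors with \<open>k\<close> in \<open>T\<close> cancel
  and the excluded parts remain.\<close>

lemma partition_gf_mult_eq_upto:
  "eq_upto (Suc K) (partition_gf T * (\<Prod>k = 1..K. 1 - fps_X ^ k)) (\<Prod>k\<in>{1..K} - T. 1 - fps_X ^ k)"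
proof -
  let ?p = "\<lambda>S. \<Prod>k\<in>S. 1 - fps_X ^ k :: real fps"
  have "?p {1..K} = ?p ({1..K} - T) * ?p (T \<inter> {1..K})"
    by (subst prod.union_disjoint[symmetric]) (auto intro!: prod.cong)
  moreover have "eq_upto (Suc K) (partition_gf T * (?p ({1..K} - T) * ?p (T \<inter> {1..K})))
     (partition_gf (T \<inter> {1..K}) * (?p ({1..K} - T) * ?p (T \<inter> {1..K})))"
    by (intro eq_upto_mult partition_gf_eq_upto eq_upto_refl)
  moreover have "partition_gf (T \<inter> {1..K}) * (?p ({1..K} - T) * ?p (T \<inter> {1..K})) = ?p ({1..K} - T)"
    by (subst mult.left_commute, subst partition_gf_finite) auto
  ultimately show ?thesis by (simp only:)
qed

lemma partition_gf_avoiding_residues: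
  assumes "0 < a" "a < M" "2 * a \<noteq> M"
  shows "eq_upto (M * N) (partition_gf {k. k mod M \<notin> {0, a, M - a}} * (\<Prod>k = 1..M * N. 1 - fps_X ^ k))
           (\<Sum>n = - int N..int N. theta_term M a n)"
proof -
  have "{1..M * N} - {k. k mod M \<notin> {0, a, M - a}} = {k. k \<in> {1..M * N} \<and> k mod M \<in> {0, a, M - a}}"
    by auto
  with partition_gf_mult_eq_upto[of "M * N" "{k. k mod M \<notin> {0, a, M - a}}"]
  have "eq_upto (Suc (M * N)) (partition_gf {k. k mod M \<notin> {0, a, M - a}} * (\<Prod>k = 1..M * N. 1 - fps_X ^ k))
      (\<Prod>k | k \<in> {1..M * N} \<and> k mod M \<in> {0, a, M - a}. 1 - fps_X ^ k)"
    by (simp only:)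
  from eq_upto_trans[OF eq_upto_mono[OF this] prod_residues_eq_upto[OF assms]]
  show ?thesis by simp
qed

text \<open>The excluded residue \<open>M\<close> is residue 0, and the other two are negatives of
  each other, as are 12 and 15, 6 and 21, 3 and 24 modulo 27.\<close>

lemma num_partitions_avoiding_eq_nth:
  fixes M a :: nat
  assumes "0 < a" "a < M"
  shows "real (num_partitions_avoiding n (int a) (int (M - a)) (int M) M)
       = fps_nth (partition_gf {k. k mod M \<notin> {0, a, M - a}}) n"
proof -
  have "[int x = int b] (mod int M) \<longleftrightarrow> x mod M = b mod M" for x b
    by (simp only: cong_int_iff) (simp add: cong_def)
  hence "x mod M \<notin> {0, a, M - a} \<longleftrightarrow> \<not> [int x = int a] (mod int M) \<and>
      \<not> [int x = int (M - a)] (mod int M) \<and> \<not> [int x = int M] (mod int M)" for x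
    using assms by (simp only:) auto
  thus ?thesis
    by (simp only: num_partitions_avoiding_def partition_gf_nth subset_iff mem_Collect_eq Ball_def)
qed

subsection \<open>Dissection of the pentagonal number series\<close>

text \<open>For \<open>M = 3\<close> and \<open>a = 1\<close> the three residue classes exhaust all
  integers.\<close>

lemma euler_product_eq_upto:
  "eq_upto (3 * N) (\<Prod>k = 1..3 * N. 1 - fps_X ^ k) (\<Sum>n = - int N..int N. theta_term 3 1 n :: 'a::field fps)"
proof -
  have "{k. k \<in> {1..3 * N} \<and> k mod 3 \<in> {0, 1, 3 - 1}} = {1..3 * N}"
    by auto
  thus ?thesis using prod_residues_eq_upto[of 1 3 N] by simp
qed

lemma euler_product_eq_qpoch: "(\<Prod>k = 1..m. 1 - fps_X ^ k) = (qpoch (fps_X ^ 1) m :: 'a::comm_ring_1 fps)"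
  by (induction m) auto

lemma euler_product_eq_upto_mono:
  assumes "K \<le> L"
  shows "eq_upto (Suc K) (\<Prod>k = 1..L. 1 - fps_X ^ k) (\<Prod>k = 1..K. 1 - fps_X ^ k :: 'a::comm_ring_1 fps)"
  using eq_upto_qpoch[OF assms, of 1] by (simp only: euler_product_eq_qpoch mult_1_left)

text \<open>Expanding the pentagonal exponent \<open>n * (3 * n - 1) / 2\<close> at
  \<open>3 * m\<close> and \<open>3 * m \<plusminus> 1\<close> gives the three quadratics. The index
  \<open>3 * m\<close> has the parity of \<open>m\<close>, the other two the opposite, whence the
  minus signs.\<close>

lemma theta_term_dissection:
  "theta_term 3 1 (3 * m) = theta_term 27 12 m"
  "theta_term 3 1 (3 * m + 1) = - (fps_X ^ 1 * theta_term 27 21 m)"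
  "theta_term 3 1 (3 * m - 1) = - (fps_X ^ 2 * theta_term 27 3 m)"
proof -
  have e: "theta_exp 3 1 (3 * m) = theta_exp 27 12 m"
    "theta_exp 3 1 (3 * m + 1) = 1 + theta_exp 27 21 m"
    "theta_exp 3 1 (3 * m - 1) = 2 + theta_exp 27 3 m"
    using of_nat_theta_exp[of 1 3 "3 * m"] of_nat_theta_exp[of 12 27 m]
      of_nat_theta_exp[of 1 3 "3 * m + 1"] of_nat_theta_exp[of 21 27 m]
      of_nat_theta_exp[of 1 3 "3 * m - 1"] of_nat_theta_exp[of 3 27 m]
    by (simp_all add: algebra_simps)
  show "theta_term 3 1 (3 * m) = theta_term 27 12 m"
    "theta_term 3 1 (3 * m + 1) = - (fps_X ^ 1 * theta_term 27 21 m)"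
    "theta_term 3 1 (3 * m - 1) = - (fps_X ^ 2 * theta_term 27 3 m)"
    unfolding theta_term_def e power_add by auto
qed

lemma sum_symmetric_interval_mod_3:
  fixes f :: "int \<Rightarrow> 'a::comm_monoid_add"
  shows "(\<Sum>n = - int (3 * N + 1)..int (3 * N + 1). f n)
      = (\<Sum>m = - int N..int N. f (3 * m) + f (3 * m + 1) + f (3 * m - 1))"
proof (induction N)
  case 0
  have "{- 1..1 :: int} = {0, 1, -1}" by auto
  thus ?case by (simp add: add.assoc)
next
  case (Suc N)
  define r where "r = int N"
  \<comment> \<open>The six new indices are the triples around \<open>3 * m\<close> for
    \<open>m = r + 1\<close> and \<open>m = - r - 1\<close>.\<close>
  have "{- int (3 * Suc N + 1)..int (3 * Suc N + 1)} = {- (3 * r) - 4, - (3 * r) - 3, - 2 - 3 * r,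
      3 * r + 2, 3 * r + 3, 3 * r + 4} \<union> {- int (3 * N + 1)..int (3 * N + 1)}"
    unfolding r_def by auto
  moreover have "{- int (Suc N)..int (Suc N)} = {- r - 1, r + 1} \<union> {- int N..int N}"
    unfolding r_def by auto
  moreover have "r \<ge> 0" by (simp add: r_def)
  ultimately show ?case
    using Suc by (simp add: sum.union_disjoint r_def[symmetric] algebra_simps)
qed

theorem theorem1:
  fixes n :: nat
  assumes "n \<ge> 2"
  shows "num_partitions_avoiding n 12 15 27 27 =
         num_partitions_avoiding (n - 1) 6 21 27 27 + num_partitions_avoiding (n - 2) 3 24 27 27"
proof -
  define N where "N = Suc n"
  \<comment> \<open>The index range $|n| \leq 3N + 1$ for modulus 3 splits exactly into three copies of $|m| \leq N$.\<close>
  define K where "K = 9 * N"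
  let ?E = "\<lambda>L. \<Prod>k = 1..L. 1 - fps_X ^ k :: real fps"
  let ?P = "\<lambda>a. partition_gf {k. k mod 27 \<notin> {0, a, 27 - a}}"
  let ?\<theta> = "\<lambda>a. \<Sum>m = - int N..int N. theta_term 27 a m :: real fps"
  have P: "eq_upto K (fps_X ^ i * (?P a * ?E (27 * N))) (fps_X ^ i * ?\<theta> a)"
    if "0 < a" "a < 27" for a i
    using that by (intro eq_upto_X_power_mult[OF partition_gf_avoiding_residues]) (auto simp: K_def, presburger)
  \<comment> \<open>The dissection yields parameter 21, while the statement is phrased with 6; both
    exclude the same residues.\<close>
  have sym: "?P 21 = ?P 6"
    by (rule arg_cong[where f = partition_gf]) auto
  have "eq_upto K ((?P 12 - fps_X ^ 1 * ?P 6 - fps_X ^ 2 * ?P 3) * ?E (27 * N))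
      (?\<theta> 12 - fps_X ^ 1 * ?\<theta> 21 - fps_X ^ 2 * ?\<theta> 3)"
    using eq_upto_diff[OF eq_upto_diff[OF P[of 12 0] P[of 21 1]] P[of 3 2]]
    unfolding sym by (simp add: algebra_simps)
  also have "?\<theta> 12 - fps_X ^ 1 * ?\<theta> 21 - fps_X ^ 2 * ?\<theta> 3
      = (\<Sum>m = - int N..int N. theta_term 3 1 (3 * m) + theta_term 3 1 (3 * m + 1) + theta_term 3 1 (3 * m - 1))"
    unfolding theta_term_dissection by (simp add: sum_distrib_left sum_subtractf)
  also have "\<dots> = (\<Sum>n = - int (3 * N + 1)..int (3 * N + 1). theta_term 3 1 n)"
    by (rule sum_symmetric_interval_mod_3[symmetric])
  also have "eq_upto K \<dots> (?E (3 * (3 * N + 1)))"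
    by (rule eq_upto_mono[OF eq_upto_sym[OF euler_product_eq_upto]]) (simp add: K_def)
  \<comment> \<open>As \<open>N\<close> is positive, \<open>9 * N + 3 \<le> 27 * N\<close>; the
    additional factors do not affect coefficients below \<open>K\<close>.\<close>
  also have "eq_upto K \<dots> (?E (27 * N))"
    by (rule eq_upto_mono[OF eq_upto_sym[OF euler_product_eq_upto_mono]]) (simp_all add: K_def N_def)
  finally have "eq_upto K ((?P 12 - fps_X ^ 1 * ?P 6 - fps_X ^ 2 * ?P 3) * ?E (27 * N)) (1 * ?E (27 * N))"
    by simp
  moreover have "fps_nth (?E (27 * N)) 0 \<noteq> 0"
    by (simp only: euler_product_eq_qpoch qpoch_X_power_nth_0 zero_less_one one_neq_zero not_False_eq_True)
  ultimately have "eq_upto K (?P 12 - fps_X ^ 1 * ?P 6 - fps_X ^ 2 * ?P 3) 1"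
    by (rule eq_upto_mult_cancel)
  hence "fps_nth (?P 12 - fps_X ^ 1 * ?P 6 - fps_X ^ 2 * ?P 3) n = fps_nth 1 n"
    unfolding eq_upto_def K_def N_def by simp
  \<comment> \<open>For \<open>n \<ge> 2\<close> the coefficient of 1 is 0, and both shifted indices
    are genuine differences.\<close>
  hence "fps_nth (?P 12) n = fps_nth (?P 6) (n - 1) + fps_nth (?P 3) (n - 2)"
    using assms by (simp only: fps_sub_nth fps_X_power_mult_nth) simp
  thus ?thesis
    using num_partitions_avoiding_eq_nth[of 12 27 n] num_partitions_avoiding_eq_nth[of 6 27 "n - 1"]
      num_partitions_avoiding_eq_nth[of 3 27 "n - 2"]
    by simp
qed

end
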